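(* Let $A$ and $B$ be Banach algebras with $\triangle(B)\neq\emptyset$, let $\theta\in\triangle(B)$, and let $\varphi\in\triangle(A)$ and $\psi\in\triangle(B)$. Then: (i) $A\times_\theta B$ is $(\varphi,\theta)$-inner amenable if and only if either $A$ is $\varphi$-inner amenable or $B$ is $\theta$-inner amenable. (ii) $A\times_\theta B$ is $(0,\psi)$-inner amenable if and only if $B$ is $\psi$-inner amenable. (iii) $A\times_\theta B$ is character inner amenable if and only if $B$ is character inner amenable.
   Context: Banach algebras are over $\mathbb{C}$. $\triangle(A)$ denotes the spectrum of $A$, i.e. the set of all nonzero multiplicative linear functionals $\varphi:A\to\mathbb{C}$. For $a,b\in A$ and $f\in A^*$, define $f\cdot a, a\cdot f\in A^*$ by $\langle f\cdot a,b\rangle=\langle f,ab\rangle$ and $\langle a\cdot f,b\rangle=\langle f,ba\rangle$. For $\varphi\in\triangle(A)$, $A$ is called $\varphi$-inner amenable if there exists $m\in A^{**}$ with $m(\varphi)=1$ and $m(f\cdot a)=m(a\cdot f)$ for all $f\in A^*$, $a\in A$. $A$ is called character inner amenable if it is $\varphi$-inner amenable for every $\varphi\in\triangle(A)$. For $\theta\in\triangle(B)$, the $\theta$-Lau product $A\times_\theta B$ is the Cartesian product $A\times B$ with multiplication $(a,b)\cdot(c,d)=(ac+\theta(d)a+\theta(b)c,\,bd)$ and norm $\|(a,b)\|=\|a\|+\|b\|$; it is a Banach algebra. Its dual is identified with $A^*\times B^*$ via $(f,g)((a,b))=f(a)+g(b)$, and $\triangle(A\times_\theta B)=(\triangle(A)\times\{\theta\})\cup(\{0\}\times\triangle(B))$.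 *)

theory Defs
  imports "HOL-Analysis.Analysis"
begin

section \<open>Complex Banach spaces and algebras\<close>

class complex_normed_vector = real_normed_vector +
  fixes scaleC :: "complex \<Rightarrow> 'a \<Rightarrow> 'a"  (infixr "*\<^sub>C" 75)
  assumes scaleC_add_right: "c *\<^sub>C (x + y) = c *\<^sub>C x + c *\<^sub>C y"
    and scaleC_add_left: "(c + d) *\<^sub>C x = c *\<^sub>C x + d *\<^sub>C x"
    and scaleC_scaleC: "c *\<^sub>C d *\<^sub>C x = (c * d) *\<^sub>C x"
    and scaleR_scaleC: "r *\<^sub>R x = complex_of_real r *\<^sub>C x"
    and norm_scaleC: "norm (c *\<^sub>C x) = cmod c * norm x"

class complex_banach = complex_normed_vector + complete_space

subclass (in complex_banach) banach ..

global_interpretation complex_vector: vector_space "scaleC :: complex \<Rightarrow> 'a \<Rightarrow> 'a::complex_normed_vector"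
proof
  fix x :: 'a
  show "1 *\<^sub>C x = x"
    using scaleR_scaleC[of 1 x] by simp
qed (simp_all add: scaleC_add_right scaleC_add_left scaleC_scaleC)

text \<open>The multiplication is a parameter and not a class operation, because a Lau product carries
  one multiplication for each functional \<open>\<theta>\<close>. No unit is assumed.\<close>

locale complex_banach_algebra =
  fixes mul :: "'a::complex_banach \<Rightarrow> 'a \<Rightarrow> 'a"
  assumes mul_assoc: "mul (mul a b) c = mul a (mul b c)"
    and mul_add_left: "mul (a + b) c = mul a c + mul b c"
    and mul_add_right: "mul a (b + c) = mul a b + mul a c"
    and mul_scaleC_left: "mul (z *\<^sub>C a) b = z *\<^sub>C mul a b"
    and mul_scaleC_right: "mul a (z *\<^sub>C b) = z *\<^sub>C mul a b"
    and norm_mul_le: "norm (mul a b) \<le> norm a * norm b"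

section \<open>Dual, bidual and spectrum\<close>

abbreviation clinear_functional :: "('a::complex_normed_vector \<Rightarrow> complex) \<Rightarrow> bool" where
  "clinear_functional f \<equiv> Vector_Spaces.linear scaleC (*) f"

definition dual_space :: "('a::complex_normed_vector \<Rightarrow> complex) set" where
  "dual_space = {f. clinear_functional f \<and> bounded_linear f}"

text \<open>Elements of the bidual are represented by functions on all of \<open>'a \<Rightarrow> complex\<close>, of which only
  the values on \<^const>\<open>dual_space\<close> matter; the norm of a functional in the dual is its
  operator norm \<^const>\<open>onorm\<close>.\<close>

definition bidual_space :: "(('a::complex_normed_vector \<Rightarrow> complex) \<Rightarrow> complex) set" where
  "bidual_space = {m.
     (\<forall>f\<in>dual_space. \<forall>g\<in>dual_space. m (\<lambda>x. f x + g x) = m f + m g) \<and>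
     (\<forall>c. \<forall>f\<in>dual_space. m (\<lambda>x. c * f x) = c * m f) \<and>
     (\<exists>K. \<forall>f\<in>dual_space. cmod (m f) \<le> K * onorm f)}"

text \<open>Continuity is not part of the definition of the spectrum; it is automatic, see
  \<open>spectrum_subset_dual\<close> below.\<close>

definition spectrum :: "('a::complex_banach \<Rightarrow> 'a \<Rightarrow> 'a) \<Rightarrow> ('a \<Rightarrow> complex) set" where
  "spectrum mul = {\<phi>. clinear_functional \<phi> \<and> (\<forall>a b. \<phi> (mul a b) = \<phi> a * \<phi> b) \<and> (\<exists>a. \<phi> a \<noteq> 0)}"

section \<open>Inner amenability\<close>

text \<open>The functionals \<open>f \<cdot> a\<close> and \<open>a \<cdot> f\<close>.\<close>

definition dual_act_right :: "('a \<Rightarrow> 'a \<Rightarrow> 'a) \<Rightarrow> ('a \<Rightarrow> complex) \<Rightarrow> 'a \<Rightarrow> ('a \<Rightarrow> complex)" where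
  "dual_act_right mul f a = (\<lambda>b. f (mul a b))"

definition dual_act_left :: "('a \<Rightarrow> 'a \<Rightarrow> 'a) \<Rightarrow> 'a \<Rightarrow> ('a \<Rightarrow> complex) \<Rightarrow> ('a \<Rightarrow> complex)" where
  "dual_act_left mul a f = (\<lambda>b. f (mul b a))"

definition inner_amenable :: "('a::complex_banach \<Rightarrow> 'a \<Rightarrow> 'a) \<Rightarrow> ('a \<Rightarrow> complex) \<Rightarrow> bool" where
  "inner_amenable mul \<phi> \<longleftrightarrow>
     (\<exists>m\<in>bidual_space. m \<phi> = 1 \<and>
        (\<forall>f\<in>dual_space. \<forall>a. m (dual_act_right mul f a) = m (dual_act_left mul a f)))"

definition character_inner_amenable :: "('a::complex_banach \<Rightarrow> 'a \<Rightarrow> 'a) \<Rightarrow> bool" where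
  "character_inner_amenable mul \<longleftrightarrow> (\<forall>\<phi>\<in>spectrum mul. inner_amenable mul \<phi>)"

section \<open>The Lau product\<close>

text \<open>A separate product type is needed: the norm on \<open>'a \<times> 'b\<close> in the library is the Euclidean one.\<close>

datatype ('a, 'b) l1_prod = L1 (l1_fst: 'a) (l1_snd: 'b)

instantiation l1_prod :: (complex_normed_vector, complex_normed_vector) complex_normed_vector
begin

definition "0 = L1 0 0"
definition "x + y = L1 (l1_fst x + l1_fst y) (l1_snd x + l1_snd y)"
definition "- x = L1 (- l1_fst x) (- l1_snd x)"
definition "x - y = L1 (l1_fst x - l1_fst y) (l1_snd x - l1_snd y)"
definition "r *\<^sub>R x = L1 (r *\<^sub>R l1_fst x) (r *\<^sub>R l1_snd x)"
definition "c *\<^sub>C x = L1 (c *\<^sub>C l1_fst x) (c *\<^sub>C l1_snd x)"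
definition "norm x = norm (l1_fst x) + norm (l1_snd x)"
definition "sgn (x :: ('a, 'b) l1_prod) = inverse (norm x) *\<^sub>R x"
definition "dist x y = norm (x - y :: ('a, 'b) l1_prod)"
definition [code del]:
  "(uniformity :: (('a, 'b) l1_prod \<times> ('a, 'b) l1_prod) filter) =
     (INF e\<in>{0<..}. principal {(x, y). dist x y < e})"
definition [code del]:
  "open (U :: ('a, 'b) l1_prod set) \<longleftrightarrow>
     (\<forall>x\<in>U. eventually (\<lambda>(x', y). x' = x \<longrightarrow> y \<in> U) uniformity)"

lemmas l1_ops = zero_l1_prod_def plus_l1_prod_def uminus_l1_prod_def minus_l1_prod_def
  scaleR_l1_prod_def scaleC_l1_prod_def norm_l1_prod_def

instance
proof
  fix x y :: "('a, 'b) l1_prod" and r :: real and c :: complex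
  show "norm (x + y) \<le> norm x + norm y"
    using norm_triangle_ineq[of "l1_fst x" "l1_fst y"] norm_triangle_ineq[of "l1_snd x" "l1_snd y"]
    by (simp add: l1_ops)
  show "norm x = 0 \<longleftrightarrow> x = 0"
    by (cases x) (simp add: l1_ops add_nonneg_eq_0_iff)
qed (simp_all add: l1_ops sgn_l1_prod_def dist_l1_prod_def uniformity_l1_prod_def
      open_l1_prod_def algebra_simps scaleC_add_right scaleC_add_left scaleC_scaleC
      scaleR_scaleC norm_scaleC split: l1_prod.splits)

end

instance l1_prod :: (complex_banach, complex_banach) complex_banach
proof
  fix X :: "nat \<Rightarrow> ('a, 'b) l1_prod"
  assume X: "Cauchy X"
  have "Cauchy (\<lambda>n. l1_fst (X n))" "Cauchy (\<lambda>n. l1_snd (X n))"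
    using X unfolding Cauchy_def dist_norm
    by (force simp: norm_l1_prod_def minus_l1_prod_def
        intro: le_less_trans[of "norm (_ :: 'a)" "norm (_ :: 'a) + norm (_ :: 'b)"]
          le_less_trans[of "norm (_ :: 'b)" "norm (_ :: 'a) + norm (_ :: 'b)"])+
  then obtain a b where ab: "(\<lambda>n. l1_fst (X n)) \<longlonglongrightarrow> a" "(\<lambda>n. l1_snd (X n)) \<longlonglongrightarrow> b"
    using Cauchy_convergent unfolding convergent_def by meson
  have "(\<lambda>n. norm (l1_fst (X n) - a) + norm (l1_snd (X n) - b)) \<longlonglongrightarrow> 0 + 0"
    using ab by (intro tendsto_add) (simp_all add: LIM_zero tendsto_norm_zero)
  then have "(\<lambda>n. norm (X n - L1 a b)) \<longlonglongrightarrow> 0"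
    by (simp add: norm_l1_prod_def minus_l1_prod_def)
  then have "X \<longlonglongrightarrow> L1 a b"
    using Lim_null tendsto_norm_zero_iff by blast
  then show "convergent X"
    by (rule convergentI)
qed

definition lau_mult :: "('a \<Rightarrow> 'a \<Rightarrow> 'a) \<Rightarrow> ('b \<Rightarrow> 'b \<Rightarrow> 'b) \<Rightarrow> ('b \<Rightarrow> complex) \<Rightarrow>
    ('a::complex_banach, 'b::complex_banach) l1_prod \<Rightarrow> ('a, 'b) l1_prod \<Rightarrow> ('a, 'b) l1_prod" where
  "lau_mult multA multB \<theta> x y =
     L1 (multA (l1_fst x) (l1_fst y) + \<theta> (l1_snd y) *\<^sub>C l1_fst x + \<theta> (l1_snd x) *\<^sub>C l1_fst y)
        (multB (l1_snd x) (l1_snd y))"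

text \<open>The functional \<open>(f, g)\<close> on the product.\<close>

definition prod_functional :: "('a \<Rightarrow> complex) \<Rightarrow> ('b \<Rightarrow> complex) \<Rightarrow> ('a, 'b) l1_prod \<Rightarrow> complex" where
  "prod_functional f g = (\<lambda>x. f (l1_fst x) + g (l1_snd x))"

section \<open>Well-definedness\<close>

lemma clinear_functional_iff:
  "clinear_functional f \<longleftrightarrow> (\<forall>x y. f (x + y) = f x + f y) \<and> (\<forall>c x. f (c *\<^sub>C x) = c * f x)"
proof -
  have "vector_space ((*) :: complex \<Rightarrow> complex \<Rightarrow> complex)"
    by unfold_locales (simp_all add: algebra_simps)
  then show ?thesis
    by (auto simp: Vector_Spaces.linear_def module_hom_def module_hom_axioms_def
        complex_vector.vector_space_axioms complex_vector.module_axioms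
        vector_space_def module_def scaleC_add_right scaleC_add_left)
qed

lemma (in complex_banach_algebra) character_norm_le:
  assumes \<phi>: "\<phi> \<in> spectrum mul"
  shows "cmod (\<phi> a) \<le> norm a"
proof (rule ccontr)
  assume "\<not> cmod (\<phi> a) \<le> norm a"
  then have gt: "norm a < cmod (\<phi> a)" by simp
  then have nz: "\<phi> a \<noteq> 0" using norm_ge_zero[of a] by (auto simp del: norm_ge_zero)
  have add: "\<phi> (x + y) = \<phi> x + \<phi> y" and sc: "\<phi> (c *\<^sub>C x) = c * \<phi> x"
    and mul: "\<phi> (mul x y) = \<phi> x * \<phi> y" for x y c
    using \<phi> by (auto simp: spectrum_def clinear_functional_iff)
  define u where "u = inverse (\<phi> a) *\<^sub>C a"
  have u1: "\<phi> u = 1" using nz by (simp add: u_def sc)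
  have nu: "norm u < 1"
    using gt nz by (simp add: u_def norm_scaleC norm_inverse norm_divide divide_simps)
  define p where "p n = (mul u ^^ n) u" for n
  have np: "norm (p n) \<le> norm u ^ n" for n
  proof (induction n)
    case 0
    then show ?case using nu by (simp add: p_def)
  next
    case (Suc n)
    have "norm (p (Suc n)) \<le> norm u * norm (p n)"
      by (simp add: p_def norm_mul_le)
    also have "\<dots> \<le> norm u * norm u ^ n"
      using Suc by (simp add: mult_left_mono)
    finally show ?case by simp
  qed
  have sp: "summable p"
    using np nu by (intro summable_comparison_test'[OF summable_geometric[of "norm u"]]) auto
  have bl: "bounded_linear (mul u)"
    by (rule bounded_linear_intro[where K = "norm u"])
      (simp_all add: mul_add_right scaleR_scaleC mul_scaleC_right norm_mul_le mult.commute
        order.trans[OF norm_mul_le])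
  have pS: "p (Suc n) = mul u (p n)" for n
    by (simp add: p_def)
  have "suminf p = p 0 + (\<Sum>n. p (Suc n))"
    using suminf_split_head[OF sp] by simp
  also have "(\<Sum>n. p (Suc n)) = mul u (suminf p)"
    using bounded_linear.suminf[OF bl sp] pS by simp
  finally have "\<phi> (suminf p) = \<phi> u + \<phi> u * \<phi> (suminf p)"
    by (metis add mul p_def funpow_0)
  then show False by (simp add: u1)
qed

lemma (in complex_banach_algebra) spectrum_subset_dual: "spectrum mul \<subseteq> dual_space"
proof
  fix \<phi> assume \<phi>: "\<phi> \<in> spectrum mul"
  then have lin: "clinear_functional \<phi>" by (simp add: spectrum_def)
  have "bounded_linear \<phi>"
    by (rule bounded_linear_intro[where K = 1])
      (use lin character_norm_le[OF \<phi>] in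
        \<open>simp_all add: clinear_functional_iff scaleR_scaleC scaleR_conv_of_real\<close>)
  with lin show "\<phi> \<in> dual_space" by (simp add: dual_space_def)
qed

lemma complex_banach_algebra_lau_mult:
  assumes "complex_banach_algebra multA" and "complex_banach_algebra multB"
    and \<theta>: "\<theta> \<in> spectrum multB"
  shows "complex_banach_algebra (lau_mult multA multB \<theta>)"
proof -
  interpret A: complex_banach_algebra multA by fact
  interpret B: complex_banach_algebra multB by fact
  have th: "\<theta> (x + y) = \<theta> x + \<theta> y" "\<theta> (c *\<^sub>C x) = c * \<theta> x" "\<theta> (multB x y) = \<theta> x * \<theta> y" for x y c
    using \<theta> by (auto simp: spectrum_def clinear_functional_iff)
  show ?thesis
  proof
    fix x y z :: "('a, 'b) l1_prod" and c :: complex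
    show "lau_mult multA multB \<theta> (lau_mult multA multB \<theta> x y) z =
        lau_mult multA multB \<theta> x (lau_mult multA multB \<theta> y z)"
      by (simp add: lau_mult_def th A.mul_assoc B.mul_assoc A.mul_add_left A.mul_add_right
          A.mul_scaleC_left A.mul_scaleC_right scaleC_add_right scaleC_scaleC algebra_simps)
    have "norm (multA (l1_fst x) (l1_fst y) + \<theta> (l1_snd y) *\<^sub>C l1_fst x + \<theta> (l1_snd x) *\<^sub>C l1_fst y)
        \<le> norm (multA (l1_fst x) (l1_fst y)) + norm (\<theta> (l1_snd y) *\<^sub>C l1_fst x)
          + norm (\<theta> (l1_snd x) *\<^sub>C l1_fst y)"
      by (meson norm_triangle_ineq add_right_mono order.trans)
    also have "\<dots> \<le> norm (l1_fst x) * norm (l1_fst y) + norm (l1_snd y) * norm (l1_fst x)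
          + norm (l1_snd x) * norm (l1_fst y)"
      unfolding norm_scaleC
      by (intro add_mono mult_right_mono A.norm_mul_le B.character_norm_le[OF \<theta>] norm_ge_zero)
    finally show "norm (lau_mult multA multB \<theta> x y) \<le> norm x * norm y"
      using B.norm_mul_le[of "l1_snd x" "l1_snd y"]
      by (simp add: lau_mult_def norm_l1_prod_def algebra_simps)
  qed (simp_all add: lau_mult_def l1_ops th A.mul_add_left A.mul_add_right B.mul_add_left
      B.mul_add_right A.mul_scaleC_left A.mul_scaleC_right B.mul_scaleC_left B.mul_scaleC_right
      scaleC_add_right scaleC_add_left scaleC_scaleC algebra_simps)
qed

end

theory Submission imports Defs begin

text \<open>In \<open>A \<times>\<^sub>\<theta> B\<close> the terms of the product that involve \<open>\<theta>\<close> are symmetric, so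
  \<open>(f, g) \<cdot> (a, b) - (a, b) \<cdot> (f, g) = (f \<cdot> a - a \<cdot> f, g \<cdot> b - b \<cdot> g)\<close>. Hence a
  functional \<open>(m, n)\<close> in \<open>A\<^sup>*\<^sup>* \<times> B\<^sup>*\<^sup>*\<close> is invariant iff \<open>m\<close> and \<open>n\<close> are,
  and \<open>(m, n)(\<phi>, \<theta>) = m \<phi> + n \<theta>\<close> is nonzero only if one of the summands is; that summand
  can be normalised. For (iii), every character of the product has a character of \<open>B\<close> as its
  second component (it is \<open>\<theta>\<close> when the first one is nonzero), and if \<open>n\<close> is invariant on \<open>B\<close> for that
  character then \<open>(0, n)\<close> is a witness on the product.\<close>

section \<open>Bounded functionals and the bidual\<close>

lemma dual_space_iff:
  "f \<in> dual_space \<longleftrightarrow>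
    (\<forall>x y. f (x + y) = f x + f y) \<and> (\<forall>c x. f (c *\<^sub>C x) = c * f x) \<and> bounded_linear f"
  by (auto simp: dual_space_def clinear_functional_iff)

lemma dual_spaceI:
  assumes "\<And>x y. f (x + y) = f x + f y" and "\<And>c x. f (c *\<^sub>C x) = c * f x"
    and "\<And>x. cmod (f x) \<le> norm x * K"
  shows "f \<in> dual_space"
  unfolding dual_space_iff using assms
  by (auto intro!: bounded_linear_intro simp: scaleR_scaleC scaleR_conv_of_real)

lemma dual_space_norm_le: "f \<in> dual_space \<Longrightarrow> cmod (f x) \<le> onorm f * norm x"
  by (simp add: dual_space_iff onorm)

lemma dual_space_zero: "f \<in> dual_space \<Longrightarrow> f 0 = 0"
  by (auto simp: dual_space_iff bounded_linear.linear linear_0)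

lemma dual_space_scale:
  assumes "f \<in> dual_space" shows "(\<lambda>x. c * f x) \<in> dual_space"
  using assms bounded_linear_mult_right[THEN bounded_linear_compose]
  by (auto simp: dual_space_iff algebra_simps)

lemma bidual_spaceD:
  assumes "m \<in> bidual_space"
  shows "f \<in> dual_space \<Longrightarrow> g \<in> dual_space \<Longrightarrow> m (\<lambda>x. f x + g x) = m f + m g"
    and "f \<in> dual_space \<Longrightarrow> m (\<lambda>x. c * f x) = c * m f"
  using assms by (auto simp: bidual_space_def)

lemma (in complex_banach_algebra) mul_zero [simp]: "mul a 0 = 0" "mul 0 a = 0"
  using mul_scaleC_right[of a 0 0] mul_scaleC_left[of 0 0 a] by simp_all

text \<open>Elements of \<open>bidual_space\<close> are linear only on \<open>dual_space\<close>, so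
  additivity can be used on \<open>f \<cdot> a\<close> and \<open>a \<cdot> f\<close> only once
  these are known to be bounded.\<close>

lemma (in complex_banach_algebra) dual_act_dual_space:
  assumes f: "f \<in> dual_space"
  shows "dual_act_right mul f a \<in> dual_space" and "dual_act_left mul a f \<in> dual_space"
proof -
  \<comment> \<open>One estimate serves both actions: \<open>x\<close> will be
    \<open>mul a y\<close> or \<open>mul y a\<close>.\<close>
  have le: "cmod (f x) \<le> norm y * (onorm f * norm a)" if "norm x \<le> norm a * norm y" for x y
  proof -
    have "cmod (f x) \<le> onorm f * norm x"
      by (rule dual_space_norm_le[OF f])
    also have "\<dots> \<le> onorm f * (norm a * norm y)"
      using f that by (intro mult_left_mono onorm_pos_le) (auto simp: dual_space_iff)
    finally show ?thesis by (simp add: ac_simps)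
  qed
  show "dual_act_right mul f a \<in> dual_space"
    by (rule dual_spaceI[where K = "onorm f * norm a"])
      (use f in \<open>auto simp: dual_act_right_def dual_space_iff mul_add_right mul_scaleC_right
        intro!: le norm_mul_le\<close>)
  have "norm (mul y a) \<le> norm a * norm y" for y
    using norm_mul_le[of y a] by (simp add: mult.commute)
  then show "dual_act_left mul a f \<in> dual_space"
    by (intro dual_spaceI[where K = "onorm f * norm a"])
      (use f in \<open>auto simp: dual_act_left_def dual_space_iff mul_add_left mul_scaleC_left
        intro!: le\<close>)
qed

text \<open>Dividing \<open>m\<close> by the scalar \<open>m \<phi>\<close> keeps linearity,
  boundedness and invariance, so a witness only has to be nonzero at \<open>\<phi>\<close>.\<close>

lemma inner_amenableI:
  assumes m: "m \<in> bidual_space" and nz: "m \<phi> \<noteq> 0"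
    and inv: "\<And>f a. f \<in> dual_space \<Longrightarrow> m (dual_act_right mul f a) = m (dual_act_left mul a f)"
  shows "inner_amenable mul \<phi>"
proof -
  define n where "n f = m f / m \<phi>" for f
  have "\<exists>K. \<forall>f\<in>dual_space. cmod (n f) \<le> K * onorm f"
  proof -
    obtain K where "\<forall>f\<in>dual_space. cmod (m f) \<le> K * onorm f"
      using m by (auto simp: bidual_space_def)
    then have "\<forall>f\<in>dual_space. cmod (n f) \<le> (K / cmod (m \<phi>)) * onorm f"
      by (simp add: n_def norm_divide divide_right_mono)
    then show ?thesis ..
  qed
  with m have "n \<in> bidual_space"
    by (auto simp: bidual_space_def n_def add_divide_distrib)
  moreover have "n \<phi> = 1" using nz by (simp add: n_def)
  ultimately show ?thesis
    unfolding inner_amenable_def using inv by (intro bexI[of _ n]) (simp_all add: n_def)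
qed

section \<open>Adjoints of contractions\<close>

text \<open>Treats the two projections and the two embeddings of the l1 sum at once.
  Multiplicativity is left out because \<open>l1_fst\<close> is not a homomorphism for the Lau
  product.\<close>

locale contraction =
  fixes T :: "'a::complex_normed_vector \<Rightarrow> 'b::complex_normed_vector"
  assumes add: "T (x + y) = T x + T y"
    and scale: "T (c *\<^sub>C x) = c *\<^sub>C T x"
    and norm_le: "norm (T x) \<le> norm x"
begin

lemma
  assumes f: "f \<in> dual_space"
  shows dual_space_comp: "(\<lambda>x. f (T x)) \<in> dual_space"
    and onorm_comp_le: "onorm (\<lambda>x. f (T x)) \<le> onorm f"
proof -
  have nn: "0 \<le> onorm f"
    using f by (auto simp: dual_space_iff intro: onorm_pos_le)
  have le: "cmod (f (T x)) \<le> onorm f * norm x" for x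
    using dual_space_norm_le[OF f, of "T x"] mult_left_mono[OF norm_le[of x] nn] by linarith
  show "(\<lambda>x. f (T x)) \<in> dual_space"
    by (rule dual_spaceI[where K = "onorm f"])
      (use f le in \<open>auto simp: dual_space_iff add scale mult.commute\<close>)
  show "onorm (\<lambda>x. f (T x)) \<le> onorm f"
    by (rule onorm_bound[OF nn le])
qed

text \<open>The functional is the second adjoint of \<open>T\<close> applied to \<open>m\<close>; it
  is bounded because the adjoint of a contraction is a contraction.\<close>

lemma bidual_space_comp:
  assumes m: "m \<in> bidual_space"
  shows "(\<lambda>f. m (\<lambda>x. f (T x))) \<in> bidual_space"
proof -
  obtain K where K: "\<forall>f\<in>dual_space. cmod (m f) \<le> K * onorm f"
    using m by (auto simp: bidual_space_def)
  \<comment> \<open>The sign of \<open>K\<close> is not prescribed; passing to the absolute value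
    makes multiplication by it monotone.\<close>
  have "cmod (m (\<lambda>x. f (T x))) \<le> \<bar>K\<bar> * onorm f" if f: "f \<in> dual_space" for f
  proof -
    have d: "(\<lambda>x. f (T x)) \<in> dual_space" by (rule dual_space_comp[OF f])
    have "cmod (m (\<lambda>x. f (T x))) \<le> K * onorm (\<lambda>x. f (T x))"
      using K d by blast
    also have "\<dots> \<le> \<bar>K\<bar> * onorm (\<lambda>x. f (T x))"
      using d by (intro mult_right_mono onorm_pos_le) (auto simp: dual_space_iff)
    also have "\<dots> \<le> \<bar>K\<bar> * onorm f"
      by (intro mult_left_mono onorm_comp_le f) simp
    finally show ?thesis .
  qed
  then show ?thesis
    using bidual_spaceD[OF m] dual_space_comp unfolding bidual_space_def by blast
qed

end

interpretation l1_fst: contraction l1_fst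
  by unfold_locales (simp_all add: l1_ops)

interpretation l1_snd: contraction l1_snd
  by unfold_locales (simp_all add: l1_ops)

interpretation l1_inl: contraction "\<lambda>a. L1 a 0"
  by unfold_locales (simp_all add: l1_ops)

interpretation l1_inr: contraction "L1 0"
  by unfold_locales (simp_all add: l1_ops)

lemma prod_functional_split:
  assumes "\<Phi> \<in> dual_space"
  shows "\<Phi> = prod_functional (\<lambda>a. \<Phi> (L1 a 0)) (\<lambda>b. \<Phi> (L1 0 b))"
proof
  fix x
  have "\<Phi> (L1 (l1_fst x) 0 + L1 0 (l1_snd x)) = \<Phi> (L1 (l1_fst x) 0) + \<Phi> (L1 0 (l1_snd x))"
    using assms by (simp add: dual_space_iff)
  then show "\<Phi> x = prod_functional (\<lambda>a. \<Phi> (L1 a 0)) (\<lambda>b. \<Phi> (L1 0 b)) x"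
    by (simp add: prod_functional_def l1_ops)
qed

section \<open>Inner amenability of the Lau product\<close>

locale lau_product = A: complex_banach_algebra multA + B: complex_banach_algebra multB
  for multA :: "'a::complex_banach \<Rightarrow> 'a \<Rightarrow> 'a" and multB :: "'b::complex_banach \<Rightarrow> 'b \<Rightarrow> 'b" +
  fixes \<theta> :: "'b \<Rightarrow> complex"
  assumes theta: "\<theta> \<in> spectrum multB"
begin

abbreviation "mulL \<equiv> lau_mult multA multB \<theta>"

sublocale L: complex_banach_algebra mulL
  by (rule complex_banach_algebra_lau_mult[OF A.complex_banach_algebra_axioms
      B.complex_banach_algebra_axioms theta])

lemma theta_dual: "\<theta> \<in> dual_space"
  using B.spectrum_subset_dual theta by blast

lemma theta_zero [simp]: "\<theta> 0 = 0"
  by (rule dual_space_zero[OF theta_dual])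

text \<open>The witness on \<open>A\<close> is \<open>m\<close> evaluated on functionals pulled back
  along \<open>l1_fst\<close>. Pulling back commutes with the two actions up to one and the same
  term, which cancels.\<close>

lemma inner_amenable_fst:
  assumes m: "m \<in> bidual_space" and nz: "m (\<lambda>x. \<phi> (l1_fst x)) \<noteq> 0"
    and inv: "\<And>F x. F \<in> dual_space \<Longrightarrow> m (dual_act_right mulL F x) = m (dual_act_left mulL x F)"
  shows "inner_amenable multA \<phi>"
proof (rule inner_amenableI[OF l1_fst.bidual_space_comp[OF m] nz])
  fix f a assume f: "f \<in> (dual_space :: ('a \<Rightarrow> complex) set)"
  have f': "f (x + y) = f x + f y" "f (c *\<^sub>C x) = c * f x" for x y c
    using f by (auto simp: dual_space_iff)
  have [simp]: "f 0 = 0" by (rule dual_space_zero[OF f])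
  let ?F = "\<lambda>x. f (l1_fst x)" and ?t = "\<lambda>x. f a * \<theta> (l1_snd x)"
  have t: "?t \<in> dual_space"
    by (intro dual_space_scale l1_snd.dual_space_comp theta_dual)
  \<comment> \<open>Multiplying \<open>y\<close> by \<open>(a, 0)\<close> on either side puts
    \<open>\<theta> (l1_snd y)\<close> times \<open>a\<close> into the first coordinate, and
    \<open>f\<close> turns this into \<open>?t\<close>.\<close>
  have "dual_act_right mulL ?F (L1 a 0) = (\<lambda>x. dual_act_right multA f a (l1_fst x) + ?t x)"
    and "dual_act_left mulL (L1 a 0) ?F = (\<lambda>x. dual_act_left multA a f (l1_fst x) + ?t x)"
    by (auto simp: dual_act_right_def dual_act_left_def lau_mult_def f' mult.commute)
  then show "m (\<lambda>x. dual_act_right multA f a (l1_fst x)) = m (\<lambda>x. dual_act_left multA a f (l1_fst x))"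
    using inv[OF l1_fst.dual_space_comp[OF f], of "L1 a 0"]
      bidual_spaceD(1)[OF m l1_fst.dual_space_comp t] A.dual_act_dual_space[OF f]
    by simp
qed

text \<open>The projection \<open>l1_snd\<close> is a homomorphism, so here pulling back commutes
  with both actions exactly.\<close>

lemma inner_amenable_snd:
  assumes m: "m \<in> bidual_space" and nz: "m (\<lambda>x. \<psi> (l1_snd x)) \<noteq> 0"
    and inv: "\<And>F x. F \<in> dual_space \<Longrightarrow> m (dual_act_right mulL F x) = m (dual_act_left mulL x F)"
  shows "inner_amenable multB \<psi>"
proof (rule inner_amenableI[OF l1_snd.bidual_space_comp[OF m] nz])
  fix g b assume g: "g \<in> (dual_space :: ('b \<Rightarrow> complex) set)"
  show "m (\<lambda>x. dual_act_right multB g b (l1_snd x)) = m (\<lambda>x. dual_act_left multB b g (l1_snd x))"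
    using inv[OF l1_snd.dual_space_comp[OF g], of "L1 0 b"]
    by (simp add: dual_act_right_def dual_act_left_def lau_mult_def)
qed

text \<open>The witness is \<open>(m, 0)\<close>: restrict a functional to the copy of
  \<open>A\<close>, then apply \<open>m\<close>.\<close>

lemma inner_amenable_lau_left:
  assumes "inner_amenable multA \<phi>"
  shows "inner_amenable mulL (prod_functional \<phi> \<theta>)"
proof -
  obtain m where m: "m \<in> bidual_space" "m \<phi> = 1"
    and inv: "\<And>f a. f \<in> dual_space \<Longrightarrow> m (dual_act_right multA f a) = m (dual_act_left multA a f)"
    using assms by (auto simp: inner_amenable_def)
  have nz: "m (\<lambda>a. prod_functional \<phi> \<theta> (L1 a 0)) \<noteq> 0"
    using m by (simp add: prod_functional_def)
  show ?thesis
  proof (rule inner_amenableI[OF l1_inl.bidual_space_comp[OF m(1)] nz])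
    fix F and x :: "('a, 'b) l1_prod"
    assume F: "F \<in> (dual_space :: (('a, 'b) l1_prod \<Rightarrow> complex) set)"
    obtain a b where x: "x = L1 a b" by (cases x)
    define f where "f = (\<lambda>a. F (L1 a 0))"
    define g where "g = (\<lambda>b. F (L1 0 b))"
    have f: "f \<in> dual_space" unfolding f_def by (rule l1_inl.dual_space_comp[OF F])
    have g: "g \<in> dual_space" unfolding g_def by (rule l1_inr.dual_space_comp[OF F])
    have FL: "F (L1 c d) = f c + g d" for c d
      using prod_functional_split[OF F] by (metis f_def g_def prod_functional_def l1_prod.sel)
    have f': "f (x + y) = f x + f y" "f (c *\<^sub>C x) = c * f x" for x y c
      using f by (auto simp: dual_space_iff)
    have [simp]: "f 0 = 0" by (rule dual_space_zero[OF f])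
    have [simp]: "g 0 = 0" by (rule dual_space_zero[OF g])
    \<comment> \<open>The element \<open>(0, b)\<close> acts on the copy of \<open>A\<close> from
      either side as the scalar \<open>\<theta> b\<close>, so both restrictions gain the same
      multiple of \<open>f\<close>.\<close>
    have "(\<lambda>c. dual_act_right mulL F x (L1 c 0)) = (\<lambda>c. dual_act_right multA f a c + \<theta> b * f c)"
      and "(\<lambda>c. dual_act_left mulL x F (L1 c 0)) = (\<lambda>c. dual_act_left multA a f c + \<theta> b * f c)"
      by (auto simp: dual_act_right_def dual_act_left_def lau_mult_def FL x f')
    then show "m (\<lambda>c. dual_act_right mulL F x (L1 c 0)) = m (\<lambda>c. dual_act_left mulL x F (L1 c 0))"
      using inv[OF f] A.dual_act_dual_space[OF f] dual_space_scale[OF f]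
      by (simp add: bidual_spaceD(1)[OF m(1)])
  qed
qed

text \<open>The witness is \<open>(0, m)\<close>, which sees \<open>\<phi>\<close> only through its
  value at 0. Leaving \<open>\<phi>\<close> otherwise free lets the lemma serve all three
  claims.\<close>

lemma inner_amenable_lau_right:
  assumes "inner_amenable multB \<psi>" and \<phi>: "\<phi> 0 = 0"
  shows "inner_amenable mulL (prod_functional \<phi> \<psi>)"
proof -
  obtain m where m: "m \<in> bidual_space" "m \<psi> = 1"
    and inv: "\<And>g b. g \<in> dual_space \<Longrightarrow> m (dual_act_right multB g b) = m (dual_act_left multB b g)"
    using assms by (auto simp: inner_amenable_def)
  have nz: "m (\<lambda>b. prod_functional \<phi> \<psi> (L1 0 b)) \<noteq> 0"
    using m by (simp add: prod_functional_def \<phi>)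
  show ?thesis
  proof (rule inner_amenableI[OF l1_inr.bidual_space_comp[OF m(1)] nz])
    fix F and x :: "('a, 'b) l1_prod"
    assume F: "F \<in> (dual_space :: (('a, 'b) l1_prod \<Rightarrow> complex) set)"
    obtain a b where x: "x = L1 a b" by (cases x)
    define f where "f = (\<lambda>a. F (L1 a 0))"
    define g where "g = (\<lambda>b. F (L1 0 b))"
    have f: "f \<in> dual_space" unfolding f_def by (rule l1_inl.dual_space_comp[OF F])
    have g: "g \<in> dual_space" unfolding g_def by (rule l1_inr.dual_space_comp[OF F])
    have FL: "F (L1 c d) = f c + g d" for c d
      using prod_functional_split[OF F] by (metis f_def g_def prod_functional_def l1_prod.sel)
    have f': "f (x + y) = f x + f y" "f (c *\<^sub>C x) = c * f x" for x y c
      using f by (auto simp: dual_space_iff)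
    have [simp]: "f 0 = 0" by (rule dual_space_zero[OF f])
    \<comment> \<open>In either order the product of \<open>(a, b)\<close> and \<open>(0, d)\<close>
      has first coordinate \<open>\<theta> d\<close> times \<open>a\<close>, so the extra term is
      the same multiple of \<open>\<theta>\<close>.\<close>
    have "(\<lambda>d. dual_act_right mulL F x (L1 0 d)) = (\<lambda>d. dual_act_right multB g b d + f a * \<theta> d)"
      and "(\<lambda>d. dual_act_left mulL x F (L1 0 d)) = (\<lambda>d. dual_act_left multB b g d + f a * \<theta> d)"
      by (auto simp: dual_act_right_def dual_act_left_def lau_mult_def FL x f')
    then show "m (\<lambda>d. dual_act_right mulL F x (L1 0 d)) = m (\<lambda>d. dual_act_left mulL x F (L1 0 d))"
      using inv[OF g] B.dual_act_dual_space[OF g] dual_space_scale[OF theta_dual]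
      by (simp add: bidual_spaceD(1)[OF m(1)])
  qed
qed

lemma inner_amenable_lau_iff:
  assumes \<phi>: "\<phi> \<in> dual_space"
  shows "inner_amenable mulL (prod_functional \<phi> \<theta>) \<longleftrightarrow>
    inner_amenable multA \<phi> \<or> inner_amenable multB \<theta>"
proof
  assume "inner_amenable mulL (prod_functional \<phi> \<theta>)"
  then obtain m where m: "m \<in> bidual_space" "m (prod_functional \<phi> \<theta>) = 1"
    and inv: "\<And>F x. F \<in> dual_space \<Longrightarrow> m (dual_act_right mulL F x) = m (dual_act_left mulL x F)"
    by (auto simp: inner_amenable_def)
  have "m (\<lambda>x. \<phi> (l1_fst x)) + m (\<lambda>x. \<theta> (l1_snd x)) = 1"
    using m bidual_spaceD(1)[OF m(1) l1_fst.dual_space_comp[OF \<phi>]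
        l1_snd.dual_space_comp[OF theta_dual]]
    by (simp add: prod_functional_def)
  then have "m (\<lambda>x. \<phi> (l1_fst x)) \<noteq> 0 \<or> m (\<lambda>x. \<theta> (l1_snd x)) \<noteq> 0"
    by auto
  then show "inner_amenable multA \<phi> \<or> inner_amenable multB \<theta>"
    using inner_amenable_fst[OF m(1) _ inv] inner_amenable_snd[OF m(1) _ inv] by blast
next
  have "\<phi> 0 = 0" by (rule dual_space_zero[OF \<phi>])
  then show "inner_amenable multA \<phi> \<or> inner_amenable multB \<theta> \<Longrightarrow>
      inner_amenable mulL (prod_functional \<phi> \<theta>)"
    using inner_amenable_lau_left inner_amenable_lau_right by blast
qed

lemma inner_amenable_lau_zero_iff:
  "inner_amenable mulL (prod_functional (\<lambda>_. 0) \<psi>) \<longleftrightarrow> inner_amenable multB \<psi>"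
proof
  assume "inner_amenable mulL (prod_functional (\<lambda>_. 0) \<psi>)"
  then obtain m where m: "m \<in> bidual_space" "m (prod_functional (\<lambda>_. 0) \<psi>) = 1"
    and inv: "\<And>F x. F \<in> dual_space \<Longrightarrow> m (dual_act_right mulL F x) = m (dual_act_left mulL x F)"
    by (auto simp: inner_amenable_def)
  then show "inner_amenable multB \<psi>"
    using inner_amenable_snd[OF m(1) _ inv] by (simp add: prod_functional_def)
qed (simp add: inner_amenable_lau_right)

section \<open>Characters of the Lau product\<close>

lemma prod_functional_zero_spectrum:
  assumes "\<psi> \<in> spectrum multB"
  shows "prod_functional (\<lambda>_. 0) \<psi> \<in> spectrum mulL"
proof -
  obtain b where "\<psi> b \<noteq> 0" using assms by (auto simp: spectrum_def)
  then have "\<exists>x :: ('a, 'b) l1_prod. prod_functional (\<lambda>_. 0) \<psi> x \<noteq> 0"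
    by (intro exI[of _ "L1 0 b"]) (simp add: prod_functional_def)
  with assms show ?thesis
    by (simp add: spectrum_def clinear_functional_iff prod_functional_def lau_mult_def l1_ops)
qed

text \<open>Since \<open>L1 0\<close> is a homomorphism, only nonvanishing is at stake: a character
  of the product cannot live on \<open>A\<close> alone.\<close>

lemma spectrum_lau_snd:
  assumes \<Phi>: "\<Phi> \<in> spectrum mulL"
  shows "(\<lambda>b. \<Phi> (L1 0 b)) \<in> spectrum multB"
proof -
  have mul: "\<Phi> (mulL x y) = \<Phi> x * \<Phi> y" for x y
    using \<Phi> by (simp add: spectrum_def)
  have d: "\<Phi> \<in> dual_space" using L.spectrum_subset_dual \<Phi> by blast
  have lin: "clinear_functional (\<lambda>b. \<Phi> (L1 0 b))"
    using l1_inr.dual_space_comp[OF d] by (simp add: dual_space_def)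
  have mulB: "\<Phi> (L1 0 (multB b c)) = \<Phi> (L1 0 b) * \<Phi> (L1 0 c)" for b c
    using mul[of "L1 0 b" "L1 0 c"] by (simp add: lau_mult_def)
  have "\<exists>b. \<Phi> (L1 0 b) \<noteq> 0"
  proof (cases "\<exists>a. \<Phi> (L1 a 0) \<noteq> 0")
    case True
    then obtain a where a: "\<Phi> (L1 a 0) \<noteq> 0" ..
    obtain b where b: "\<theta> b \<noteq> 0" using theta by (auto simp: spectrum_def)
    \<comment> \<open>From \<open>(a, 0) (0, b) = \<theta> b (a, 0)\<close> and
      \<open>\<Phi> (L1 a 0) \<noteq> 0\<close> it follows that \<open>\<Phi> (L1 0 b)\<close>
      equals \<open>\<theta> b\<close>, which is nonzero.\<close>
    have "\<Phi> (L1 a 0) * \<Phi> (L1 0 b) = \<Phi> (\<theta> b *\<^sub>C L1 a 0)"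
      using mul[of "L1 a 0" "L1 0 b"] by (simp add: lau_mult_def l1_ops)
    also have "\<dots> = \<theta> b * \<Phi> (L1 a 0)"
      using d by (simp add: dual_space_iff)
    finally show ?thesis using a b by (metis mult_eq_0_iff)
  next
    case False
    obtain x where "\<Phi> x \<noteq> 0" using \<Phi> by (auto simp: spectrum_def)
    then have "\<Phi> (L1 0 (l1_snd x)) \<noteq> 0"
      using False prod_functional_split[OF d] by (metis prod_functional_def add_0)
    then show ?thesis ..
  qed
  with lin mulB show ?thesis by (simp add: spectrum_def)
qed

lemma character_inner_amenable_lau_iff:
  "character_inner_amenable mulL \<longleftrightarrow> character_inner_amenable multB"
proof
  assume "character_inner_amenable mulL"
  then show "character_inner_amenable multB"
    unfolding character_inner_amenable_def
    using prod_functional_zero_spectrum inner_amenable_lau_zero_iff by blast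
next
  assume B: "character_inner_amenable multB"
  show "character_inner_amenable mulL"
    unfolding character_inner_amenable_def
  proof
    fix \<Phi> assume \<Phi>: "\<Phi> \<in> spectrum mulL"
    have d: "\<Phi> \<in> dual_space" using L.spectrum_subset_dual \<Phi> by blast
    have z: "\<Phi> (L1 0 0) = 0"
      by (rule dual_space_zero[OF l1_inl.dual_space_comp[OF d]])
    have "inner_amenable multB (\<lambda>b. \<Phi> (L1 0 b))"
      using B spectrum_lau_snd[OF \<Phi>] by (simp add: character_inner_amenable_def)
    \<comment> \<open>The first component is the restriction of \<open>\<Phi>\<close> to
      \<open>A\<close>, whether zero or not, so the two kinds of characters need no case
      split.\<close>
    from inner_amenable_lau_right[OF this, of "\<lambda>a. \<Phi> (L1 a 0)"] z
    show "inner_amenable mulL \<Phi>"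
      using prod_functional_split[OF d] by simp
  qed
qed

end

theorem theorem4p1:
  fixes multA :: "'a::complex_banach \<Rightarrow> 'a \<Rightarrow> 'a"
    and multB :: "'b::complex_banach \<Rightarrow> 'b \<Rightarrow> 'b"
    and \<theta> \<psi> :: "'b \<Rightarrow> complex" and \<phi> :: "'a \<Rightarrow> complex"
  assumes "complex_banach_algebra multA" and "complex_banach_algebra multB"
    and "spectrum multB \<noteq> {}" and "\<theta> \<in> spectrum multB"
    and "\<phi> \<in> spectrum multA" and "\<psi> \<in> spectrum multB"
  shows "(inner_amenable (lau_mult multA multB \<theta>) (prod_functional \<phi> \<theta>) \<longleftrightarrow>
           inner_amenable multA \<phi> \<or> inner_amenable multB \<theta>) \<and>
         (inner_amenable (lau_mult multA multB \<theta>) (prod_functional (\<lambda>_. 0) \<psi>) \<longleftrightarrow>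
           inner_amenable multB \<psi>) \<and>
         (character_inner_amenable (lau_mult multA multB \<theta>) \<longleftrightarrow> character_inner_amenable multB)"
proof -
  interpret lau_product multA multB \<theta>
    using assms by (simp add: lau_product_def lau_product_axioms_def)
  have "\<phi> \<in> dual_space"
    using assms(5) A.spectrum_subset_dual by blast
  then show ?thesis
    using inner_amenable_lau_iff inner_amenable_lau_zero_iff character_inner_amenable_lau_iff
    by simp
qed

end
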